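(* For an integer $n\geq 0$, the Francois quaternion $\mathbb{Q}\mathcal{F}_{n}$ is a zero divisor in the quaternion algebra $\mathbb{Q}_{\mathbb{Z}_{5}}$ if and only if $n\equiv 5,8,10,19 \pmod{20}$.
   Context: The Francois numbers are defined by $\mathcal{F}_{0}=2$, $\mathcal{F}_{1}=1$, $\mathcal{F}_{n}=\mathcal{F}_{n-1}+\mathcal{F}_{n-2}+1$ for $n\geq 2$. For an odd prime $q$, let $\mathbb{Z}_q$ be the field with $q$ elements and $\mathbb{Q}_{\mathbb{Z}_{q}}$ the quaternion algebra over $\mathbb{Z}_q$ with basis $1,i,j,k$ and relations $i^{2}=j^{2}=-1$, $ij=-ji=k$. The $n$-th Francois quaternion is $\mathbb{Q}\mathcal{F}_{n}=\mathcal{F}_{n}+\mathcal{F}_{n+1}i+\mathcal{F}_{n+2}j+\mathcal{F}_{n+3}k$, regarded as an element of $\mathbb{Q}_{\mathbb{Z}_{q}}$ by reducing its coefficients modulo $q$. *)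

theory Defs
  imports "HOL-Library.Numeral_Type" "HOL-Number_Theory.Cong"
begin

fun francois :: "nat \<Rightarrow> nat" where
  "francois 0 = 2"
| "francois (Suc 0) = 1"
| "francois (Suc (Suc n)) = francois (Suc n) + francois n + 1"

text \<open>
  \<open>Quat a b c d\<close> stands for $a + b i + c j + d k$. The product is the bilinear extension of
  $i^2 = j^2 = -1$, $ij = -ji = k$; the lemmas \<open>quat_relations\<close> and \<open>Quat_eq_basis\<close> below
  confirm this.
\<close>

datatype 'a quat = Quat (qRe: 'a) (qI: 'a) (qJ: 'a) (qK: 'a)

instantiation quat :: (comm_ring_1) ring_1
begin

definition zero_quat :: "'a quat" where
  "0 = Quat 0 0 0 0"

definition one_quat :: "'a quat" where
  "1 = Quat 1 0 0 0"

definition plus_quat :: "'a quat \<Rightarrow> 'a quat \<Rightarrow> 'a quat" where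
  "x + y = Quat (qRe x + qRe y) (qI x + qI y) (qJ x + qJ y) (qK x + qK y)"

definition uminus_quat :: "'a quat \<Rightarrow> 'a quat" where
  "- x = Quat (- qRe x) (- qI x) (- qJ x) (- qK x)"

definition minus_quat :: "'a quat \<Rightarrow> 'a quat \<Rightarrow> 'a quat" where
  "x - y = Quat (qRe x - qRe y) (qI x - qI y) (qJ x - qJ y) (qK x - qK y)"

definition times_quat :: "'a quat \<Rightarrow> 'a quat \<Rightarrow> 'a quat" where
  "x * y = Quat
     (qRe x * qRe y - qI x * qI y - qJ x * qJ y - qK x * qK y)
     (qRe x * qI y + qI x * qRe y + qJ x * qK y - qK x * qJ y)
     (qRe x * qJ y - qI x * qK y + qJ x * qRe y + qK x * qI y)
     (qRe x * qK y + qI x * qJ y - qJ x * qI y + qK x * qRe y)"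

instance
  by standard
    (simp_all add: zero_quat_def one_quat_def plus_quat_def uminus_quat_def minus_quat_def
      times_quat_def algebra_simps)

end

definition quat_i :: "'a::comm_ring_1 quat" where "quat_i = Quat 0 1 0 0"
definition quat_j :: "'a::comm_ring_1 quat" where "quat_j = Quat 0 0 1 0"
definition quat_k :: "'a::comm_ring_1 quat" where "quat_k = Quat 0 0 0 1"

definition quat_scalar :: "'a::comm_ring_1 \<Rightarrow> 'a quat" where
  "quat_scalar a = Quat a 0 0 0"

lemmas quat_defs = zero_quat_def one_quat_def plus_quat_def uminus_quat_def minus_quat_def
  times_quat_def quat_i_def quat_j_def quat_k_def quat_scalar_def

lemma quat_relations:
  "quat_i * quat_i = (- 1 :: 'a::comm_ring_1 quat)"
  "quat_j * quat_j = (- 1 :: 'a::comm_ring_1 quat)"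
  "quat_i * quat_j = (quat_k :: 'a::comm_ring_1 quat)"
  "quat_j * quat_i = (- quat_k :: 'a::comm_ring_1 quat)"
  by (simp_all add: quat_defs)

lemma Quat_eq_basis:
  "Quat a b c d = quat_scalar a + quat_scalar b * quat_i + quat_scalar c * quat_j
    + quat_scalar d * quat_k"
  by (simp add: quat_defs)

lemma quat_scalar_hom:
  "quat_scalar (a + b) = quat_scalar a + quat_scalar b"
  "quat_scalar (a * b) = quat_scalar a * quat_scalar b"
  "quat_scalar 1 = 1"
  "quat_scalar a * x = x * quat_scalar a"
  by (simp_all add: quat_defs algebra_simps)

text \<open>For the coefficient type \<open>'a = 5\<close>, \<open>of_nat\<close> is reduction modulo 5.\<close>

definition francois_quat :: "nat \<Rightarrow> 'a::comm_ring_1 quat" where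
  "francois_quat n = Quat (of_nat (francois n)) (of_nat (francois (n + 1)))
     (of_nat (francois (n + 2))) (of_nat (francois (n + 3)))"

text \<open>
  Zero divisors are nonzero, and annihilation on either side counts.
\<close>

definition zero_divisor :: "'a::ring \<Rightarrow> bool" where
  "zero_divisor x \<longleftrightarrow> x \<noteq> 0 \<and> (\<exists>y. y \<noteq> 0 \<and> (x * y = 0 \<or> y * x = 0))"

text \<open>
  The numeral type \<open>5\<close> is the ring of integers modulo 5; the library provides only its
  commutative ring structure, so that it is a field is recorded here.
\<close>

lemma five_inverse:
  fixes x :: 5
  assumes "x \<noteq> 0"
  shows "\<exists>y. x * y = 1"
proof (cases x)
  case (of_int z)
  then have "z \<in> {0, 1, 2, 3, 4}" by auto
  moreover have "(1::5) * 1 = 1" "(2::5) * 3 = 1" "(3::5) * 2 = 1" "(4::5) * 4 = 1"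
    by simp_all
  ultimately show ?thesis using of_int assms
    by (elim insertE) (simp, metis of_int_1, metis of_int_numeral, metis of_int_numeral,
      metis of_int_numeral, simp)
qed

end

theory Submission imports Defs begin

text \<open>
  Multiplying a quaternion by its conjugate gives its norm, the sum of the squares of its four
  coefficients. Over a field this turns the question into one about the norm: a nonzero quaternion
  of norm \<open>0\<close> is annihilated by its (nonzero) conjugate, and a quaternion of invertible norm is
  itself invertible. This is \<open>zero_divisor_five_iff\<close>.

  The recurrence \<open>(a, b) \<mapsto> (b, a + b + 1)\<close> for consecutive Francois numbers has period 20 on
  the pair \<open>(2, 1)\<close> modulo 5 (\<open>of_nat_francois_five\<close>), so only 20 quaternions occur
  modulo 5. None of them is zero, and the norm vanishes exactly at the indices 5, 8, 10 and 19.
\<close>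

definition qconj :: "'a::comm_ring_1 quat \<Rightarrow> 'a quat" where
  "qconj x = Quat (qRe x) (- qI x) (- qJ x) (- qK x)"

definition qnorm :: "'a::comm_ring_1 quat \<Rightarrow> 'a" where
  "qnorm x = qRe x ^ 2 + qI x ^ 2 + qJ x ^ 2 + qK x ^ 2"

lemma mult_qconj: "x * qconj x = quat_scalar (qnorm x)"
  by (simp add: quat_defs qconj_def qnorm_def power2_eq_square algebra_simps)

lemma qconj_mult: "qconj x * x = quat_scalar (qnorm x)"
  by (simp add: quat_defs qconj_def qnorm_def power2_eq_square algebra_simps)

lemma qconj_eq_0_iff: "qconj x = 0 \<longleftrightarrow> x = 0"
  by (cases x) (simp add: quat_defs qconj_def)

lemma zero_divisor_if_qnorm_0:
  assumes "x \<noteq> 0" "qnorm x = 0"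
  shows "zero_divisor x"
proof -
  have "x * qconj x = 0"
    unfolding mult_qconj assms(2) by (simp add: quat_defs)
  moreover have "qconj x \<noteq> 0"
    using assms(1) by (simp add: qconj_eq_0_iff)
  ultimately show ?thesis
    using assms(1) unfolding zero_divisor_def by blast
qed

text \<open>If \<open>u\<close> inverts the norm, then \<open>u\<close> times the conjugate is a two-sided inverse, and a unit
  annihilates only \<open>0\<close>.\<close>

lemma not_zero_divisor_if_qnorm_unit:
  assumes "qnorm x * u = 1"
  shows "\<not> zero_divisor x"
proof -
  define z where "z = qconj x * quat_scalar u"
  have unit: "quat_scalar (qnorm x) * quat_scalar u = 1"
    by (simp only: assms quat_scalar_hom(3) flip: quat_scalar_hom(2))
  have right: "x * z = 1"
    by (simp only: z_def mult_qconj unit flip: mult.assoc)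
  have "z * x = qconj x * x * quat_scalar u"
    by (simp only: z_def mult.assoc quat_scalar_hom(4)[of u x])
  then have left: "z * x = 1"
    by (simp only: qconj_mult unit)
  have "y = 0" if "x * y = 0 \<or> y * x = 0" for y
    using that
  proof
    assume "x * y = 0"
    then have "z * x * y = 0"
      by (simp only: mult.assoc mult_zero_right)
    then show "y = 0"
      by (simp only: left mult_1_left)
  next
    assume "y * x = 0"
    then have "y * (x * z) = 0"
      by (simp only: mult_zero_left flip: mult.assoc)
    then show "y = 0"
      by (simp only: right mult_1_right)
  qed
  then show ?thesis
    unfolding zero_divisor_def by blast
qed

lemma zero_divisor_five_iff:
  fixes x :: "5 quat"
  shows "zero_divisor x \<longleftrightarrow> x \<noteq> 0 \<and> qnorm x = 0"
proof
  assume zd: "zero_divisor x"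
  then have "x \<noteq> 0"
    by (simp add: zero_divisor_def)
  moreover have "qnorm x = 0"
  proof (rule ccontr)
    assume "qnorm x \<noteq> 0"
    then obtain u where "qnorm x * u = 1"
      using five_inverse by blast
    then show False
      using zd by (simp add: not_zero_divisor_if_qnorm_unit)
  qed
  ultimately show "x \<noteq> 0 \<and> qnorm x = 0"
    by (rule conjI)
next
  assume "x \<noteq> 0 \<and> qnorm x = 0"
  then show "zero_divisor x"
    by (intro zero_divisor_if_qnorm_0) simp_all
qed

definition francois_five_period :: "5 list" where
  "francois_five_period = [2, 1, 4, 1, 1, 3, 0, 4, 0, 0, 1, 2, 4, 2, 2, 0, 3, 4, 3, 3]"

lemma mod_20_cases:
  fixes n :: nat
  shows "n mod 20 \<in> {0, 1, 2, 3, 4, 5, 6, 7, 8, 9, 10, 11, 12, 13, 14, 15, 16, 17, 18, 19}"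
proof -
  have "n mod 20 \<in> set [0..<20]"
    by simp
  also have "[0..<20] = [0, 1, 2, 3, 4, 5, 6, 7, 8, 9, 10, 11, 12, 13, 14, 15, 16, 17, 18, 19]"
    by (simp add: upt_rec)
  finally show ?thesis
    by (simp only: list.set)
qed

text \<open>The list is closed under the recurrence when read cyclically, so it determines
  the Francois numbers modulo 5 for every index.\<close>

lemma francois_five_period_rec:
  "francois_five_period ! ((n + 2) mod 20) =
    francois_five_period ! ((n + 1) mod 20) + francois_five_period ! (n mod 20) + 1"
proof -
  have shift: "(n + k) mod 20 = (n mod 20 + k) mod 20" for k
    by (simp add: mod_simps)
  show ?thesis
    using mod_20_cases[of n] unfolding shift
    by (elim insertE) (simp_all add: francois_five_period_def)
qed

lemma of_nat_francois_five:
  "(of_nat (francois n) :: 5) = francois_five_period ! (n mod 20)"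
proof (induction n rule: francois.induct)
  case 1
  show ?case by (simp add: francois_five_period_def)
next
  case 2
  show ?case by (simp add: francois_five_period_def)
next
  case (3 n)
  then show ?case
    using francois_five_period_rec[of n] by simp
qed

theorem proposition9:
  fixes n :: nat
  shows "zero_divisor (francois_quat n :: 5 quat) \<longleftrightarrow>
    (\<exists>r \<in> {5, 8, 10, 19}. [n = r] (mod 20))"
proof -
  have shift: "(n + k) mod 20 = (n mod 20 + k) mod 20" for k
    by (simp add: mod_simps)
  have "zero_divisor (francois_quat n :: 5 quat) \<longleftrightarrow> n mod 20 \<in> {5, 8, 10, 19}"
    using mod_20_cases[of n]
    unfolding zero_divisor_five_iff francois_quat_def of_nat_francois_five shift
    by (elim insertE) (simp_all add: francois_five_period_def qnorm_def zero_quat_def)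
  then show ?thesis
    by (simp add: cong_def)
qed

end
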